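(* For all positive integers $n$ we have $$\mathcal{N}i(n)=O\left(2^n n^{-0.2075}\right),$$ while for infinitely many positive integers $n$ we have $$\mathcal{N}i(n)\ge 2^{\,n-2^{(1+o(1))\sqrt{\log_2 n}}},$$ where the $o(1)$ term tends to $0$ as $n\to\infty$ along this infinite set of integers $n$.
   Context: Graphs are finite and simple (no loops or multiple edges). $\mathcal{G}_n$ denotes the family of (unlabelled) graphs on $n$ vertices. For a graph $G$, $i(G)$ denotes the number of independent subsets of the vertex set of $G$ (sets of vertices inducing no edge), the empty set included. Define $\mathcal{N}i(n):=|\{i(G): G\in\mathcal{G}_n\}|$, the number of distinct values taken by $i(G)$ over all $n$-vertex graphs $G$. *)

theory Defs
  imports "HOL-Analysis.Analysis" "Graph_Theory.Pair_Digraph"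
begin

text \<open>
  A finite simple graph is a \<^locale>\<open>pair_graph\<close>: a finite vertex set together with an
  irreflexive symmetric set of ordered pairs of vertices.
\<close>

definition independent_sets :: "'a pair_pre_digraph \<Rightarrow> 'a set set" where
  "independent_sets G = {S. S \<subseteq> pverts G \<and> (\<forall>u\<in>S. \<forall>v\<in>S. (u, v) \<notin> parcs G)}"

definition num_indep :: "'a pair_pre_digraph \<Rightarrow> nat" where
  "num_indep G = card (independent_sets G)"

text \<open>
  Every finite graph is isomorphic to one whose vertices are natural numbers, and
  \<^const>\<open>num_indep\<close> is invariant under isomorphism, so the values taken on unlabelled graphs
  of order \<open>n\<close> are the values taken on this set of representatives. The set itself is infinite,
  but its image under \<^const>\<open>num_indep\<close> is finite (see below).
\<close>

definition graphs_of_order :: "nat \<Rightarrow> nat pair_pre_digraph set" where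
  "graphs_of_order n = {G. pair_graph G \<and> card (pverts G) = n}"

definition Ni :: "nat \<Rightarrow> nat" where
  "Ni n = card (num_indep ` graphs_of_order n)"

lemma num_indep_le:
  assumes "G \<in> graphs_of_order n"
  shows "num_indep G \<le> 2 ^ n"
proof -
  interpret pair_graph G using assms by (simp add: graphs_of_order_def)
  have "num_indep G \<le> card (Pow (pverts G))"
    unfolding num_indep_def by (rule card_mono) (auto simp: independent_sets_def)
  then show ?thesis using assms by (simp add: card_Pow graphs_of_order_def)
qed

lemma finite_num_indep_image: "finite (num_indep ` graphs_of_order n)"
  by (rule finite_subset[of _ "{..2 ^ n}"]) (auto intro: num_indep_le)

end

theory Submission
  imports Defs "HOL-Real_Asymp.Real_Asymp" "HOL-Library.Nat_Bijection"
begin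

text \<open>
  Upper bound. Delete the two ends of an edge: the independent sets of the smaller graph extend in at
  most three of the four possible ways. So \<open>k\<close> disjoint edges force \<open>i(G) \<le> (3/4) ^ k * 2 ^ n\<close>,
  and these values are few because they are small. If there are no \<open>k\<close> disjoint edges, some set
  \<open>C\<close> of at most \<open>2 * k\<close> vertices meets all edges, and \<open>i(G)\<close> is determined by the independent
  subsets of \<open>C\<close> together with the number of outside vertices of each type (the type being the
  neighbourhood in \<open>C\<close>); this leaves at most \<open>(2 * (n + 1)) ^ 4 ^ k\<close> values (lemma \<open>Ni_le\<close>).
  The second family stays negligible as long as \<open>4 ^ k\<close> is a power of \<open>n\<close> with exponent below
  \<open>1\<close>, so \<open>k\<close> may be almost \<open>log 2 n / 2\<close>, and \<open>(3/4) ^ k\<close> is then almost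
  \<open>n powr (- log 2 (4/3) / 2) = n powr (- 0.20751...)\<close>.

  Lower bound. If the graph consists of a small core and of a large independent set of outer vertices,
  then \<open>i(G)\<close> is the sum over the independent core sets \<open>S\<close> of \<open>2 ^ f S\<close>, where \<open>f S\<close> counts the
  outer vertices without a neighbour in \<open>S\<close> (lemma \<open>card_indep_split\<close>). The construction arranges
  that almost every number \<open>p\<close> below the number of outer vertices belongs to one core set \<open>S\<close> with
  \<open>f S = p + b\<close>, where the switch \<open>b\<close> in \<open>{0, 1}\<close> can be chosen separately for each \<open>p\<close>,
  while no other core set notices the switches. Since \<open>2 ^ (p + b) = 2 ^ p + b * 2 ^ p\<close>, the value
  \<open>i(G)\<close> is a constant plus the number whose binary digits are the switches (lemma \<open>core_sum_eq\<close>),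
  so each switch doubles the number of values.

  To make a core of \<open>2 ^ R\<close> vertices, up to a factor polynomial in \<open>R\<close>, address at least
  \<open>2 ^ (R * R)\<close> switches, the binary digits
  of \<open>p\<close> are cut into blocks of \<open>R\<close> digits. For each block there is a clique with one vertex for each
  of the \<open>2 ^ R\<close> contents of that block; a core set with one vertex in each clique then spells out a
  number \<open>p\<close>. Core sets that miss a clique are unavoidable, as independence passes to subsets. To
  keep them insensitive to the switches, one clique is set apart, and each combination of contents of
  the other \<open>R\<close> cliques gets \<open>2 ^ R\<close> outer vertices, one for each set of these cliques. The
  special clique decides with the help of the switches which of them are free, and the effects cancel
  in pairs unless all cliques are present (lemma \<open>card_free_independent_of_switches\<close>). These outer
  vertices are as many as the numbers \<open>p\<close> that one such core addresses, so a core only serves the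
  lower half of all positions; a further core, joined completely to the first one, serves the lower
  half of what remains, and so on.
\<close>

section \<open>Independent sets\<close>

text \<open>
  Vertex set and adjacency are separate arguments, so that passing to a subset of the vertices leaves
  the relation \<open>E\<close>, which may relate points outside \<open>V\<close>, unchanged.
\<close>
definition indep :: "('a \<times> 'a) set \<Rightarrow> 'a set \<Rightarrow> 'a set set" where
  "indep E V = {S. S \<subseteq> V \<and> (\<forall>u\<in>S. \<forall>v\<in>S. (u, v) \<notin> E)}"

lemma num_indep_eq: "num_indep G = card (indep (parcs G) (pverts G))"
  by (simp add: num_indep_def independent_sets_def indep_def)

lemma finite_indep: "finite V \<Longrightarrow> finite (indep E V)"
  by (rule finite_subset[of _ "Pow V"]) (auto simp: indep_def)

text \<open>
  Graphs can be built on whatever vertex type is convenient: an injection into the natural numbers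
  carries the independent sets along.
\<close>
lemma relabel_graph:
  assumes fin: "finite V" and sy: "sym E" and irr: "irrefl E"
  shows "card (indep E V) \<in> num_indep ` graphs_of_order (card V)"
proof -
  obtain f :: "'a \<Rightarrow> nat" where f: "inj_on f V"
    using finite_imp_inj_to_nat_seg[OF fin] by blast
  define A where "A = {(f u, f v) |u v. u \<in> V \<and> v \<in> V \<and> (u, v) \<in> E}"
  define G where "G = \<lparr>pverts = f ` V, parcs = A\<rparr>"
  have A_iff: "(f u, f v) \<in> A \<longleftrightarrow> (u, v) \<in> E" if "u \<in> V" "v \<in> V" for u v
    using that f by (auto simp: A_def inj_on_def)
  have "pair_graph G"
  proof unfold_locales
    show "finite (parcs G)"
      by (rule finite_subset[of _ "f ` V \<times> f ` V"]) (auto simp: G_def A_def fin)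
    show "symmetric (with_proj G)"
      unfolding symmetric_def using sy
      by (auto simp: G_def A_def sym_def arcs_ends_def arc_to_ends_def)
    show "fst e \<noteq> snd e" if "e \<in> parcs G" for e
    proof -
      from that obtain u v where uv: "e = (f u, f v)" "u \<in> V" "v \<in> V" "(u, v) \<in> E"
        by (auto simp: G_def A_def)
      with irr have "u \<noteq> v" by (auto simp: irrefl_def)
      with uv f show ?thesis by (simp add: inj_on_eq_iff)
    qed
  qed (auto simp: G_def A_def fin)
  then have "G \<in> graphs_of_order (card V)"
    using f by (simp add: graphs_of_order_def G_def card_image)
  moreover have "num_indep G = card (indep E V)"
  proof -
    have "indep A (f ` V) = (`) f ` indep E V"
    proof (intro equalityI subsetI)
      fix T assume T: "T \<in> indep A (f ` V)"
      define S where "S = {v \<in> V. f v \<in> T}"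
      have "T = f ` S" using T by (auto simp: S_def indep_def)
      moreover have "S \<in> indep E V"
        using T A_iff unfolding S_def indep_def by blast
      ultimately show "T \<in> (`) f ` indep E V" by blast
    next
      fix T assume "T \<in> (`) f ` indep E V"
      then obtain S where S: "T = f ` S" "S \<in> indep E V" by blast
      then show "T \<in> indep A (f ` V)"
        using A_iff by (auto simp: indep_def subset_iff)
    qed
    moreover have "inj_on ((`) f) (indep E V)"
      using inj_on_image_Pow[OF f] by (rule inj_on_subset) (auto simp: indep_def)
    ultimately show ?thesis
      by (simp add: num_indep_eq G_def card_image)
  qed
  ultimately show ?thesis by (metis imageI)
qed

text \<open>
  An independent set is an independent set \<open>S\<close> of the core \<open>K\<close> together with any set of outer
  vertices that have no neighbour in \<open>S\<close>. Both bounds rest on this formula.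
\<close>
lemma card_indep_split:
  assumes fin: "finite K" "finite U" and disj: "K \<inter> U = {}" and sy: "sym E"
    and U: "\<And>u v. u \<in> U \<Longrightarrow> v \<in> U \<Longrightarrow> (u, v) \<notin> E"
  shows "card (indep E (K \<union> U)) = (\<Sum>S\<in>indep E K. 2 ^ card {u \<in> U. \<forall>v\<in>S. (v, u) \<notin> E})"
proof -
  let ?F = "\<lambda>S. {u \<in> U. \<forall>v\<in>S. (v, u) \<notin> E}"
  have "bij_betw (\<lambda>(S, T). S \<union> T) (Sigma (indep E K) (\<lambda>S. Pow (?F S))) (indep E (K \<union> U))"
  proof (rule bij_betwI[where g = "\<lambda>W. (W \<inter> K, W \<inter> U)"])
    show "(\<lambda>(S, T). S \<union> T) \<in> Sigma (indep E K) (\<lambda>S. Pow (?F S)) \<rightarrow> indep E (K \<union> U)"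
    proof (intro funcsetI, clarify)
      fix S T assume S: "S \<in> indep E K" and T: "T \<subseteq> ?F S"
      have "(u, v) \<notin> E" if "u \<in> S" "v \<in> T" for u v using T that by blast
      moreover from this have "(v, u) \<notin> E" if "u \<in> S" "v \<in> T" for u v
        using that symD[OF sy] by blast
      moreover have "(u, v) \<notin> E" if "u \<in> T" "v \<in> T" for u v using T that U by blast
      ultimately show "S \<union> T \<in> indep E (K \<union> U)"
        using S T by (auto simp: indep_def)
    qed
    show "(\<lambda>W. (W \<inter> K, W \<inter> U)) \<in> indep E (K \<union> U) \<rightarrow> Sigma (indep E K) (\<lambda>S. Pow (?F S))"
      by (auto simp: indep_def)
  qed (use disj in \<open>auto simp: indep_def\<close>)
  then have "card (indep E (K \<union> U)) = card (Sigma (indep E K) (\<lambda>S. Pow (?F S)))"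
    by (simp add: bij_betw_same_card)
  also have "\<dots> = (\<Sum>S\<in>indep E K. card (Pow (?F S)))"
    by (rule card_SigmaI) (use fin in \<open>auto simp: finite_indep\<close>)
  also have "\<dots> = (\<Sum>S\<in>indep E K. 2 ^ card (?F S))"
    using fin by (simp add: card_Pow)
  finally show ?thesis .
qed

section \<open>Upper bound\<close>

lemma card_indep_remove_edge:
  assumes fin: "finite V" and uv: "u \<in> V" "v \<in> V" "(u, v) \<in> E"
  shows "card (indep E V) \<le> 3 * card (indep E (V - {u, v}))"
proof -
  let ?h = "\<lambda>S. (S \<inter> {u, v}, S - {u, v})"
  have "card (indep E V) \<le> card ({{}, {u}, {v}} \<times> indep E (V - {u, v}))"
  proof (rule card_inj_on_le[of ?h])
    show "inj_on ?h (indep E V)"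
      by (auto simp: inj_on_def)
    show "?h ` indep E V \<subseteq> {{}, {u}, {v}} \<times> indep E (V - {u, v})"
      using uv by (auto simp: indep_def)
  qed (use fin in \<open>auto simp: finite_indep\<close>)
  also have "\<dots> = card {{}, {u}, {v}} * card (indep E (V - {u, v}))"
    by (rule card_cartesian_product)
  also have "card {{}, {u}, {v}} \<le> 3"
    by (simp add: card_insert_if)
  finally show ?thesis by simp
qed

text \<open>
  Induction on \<open>k\<close>, removing both ends of one edge at a time. Each removal costs a factor \<open>3 / 4\<close>
  relative to the number of all subsets; a small cover of what remains becomes a cover of the whole
  by adding the two removed vertices.
\<close>
lemma few_indep_or_small_cover:
  assumes "finite V" "irrefl E"
  shows "4 ^ k * card (indep E V) \<le> 3 ^ k * 2 ^ card V
    \<or> (\<exists>C\<subseteq>V. card C \<le> 2 * k \<and> (\<forall>u\<in>V - C. \<forall>v\<in>V - C. (u, v) \<notin> E))"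
  using assms(1)
proof (induction k arbitrary: V)
  case 0
  have "card (indep E V) \<le> card (Pow V)"
    by (rule card_mono) (use 0 in \<open>auto simp: indep_def\<close>)
  then show ?case using 0 by (simp add: card_Pow)
next
  case (Suc k)
  show ?case
  proof (cases "\<forall>u\<in>V. \<forall>v\<in>V. (u, v) \<notin> E")
    case True
    then show ?thesis by (intro disjI2 exI[of _ "{}"]) auto
  next
    case False
    then obtain u v where uv: "u \<in> V" "v \<in> V" "(u, v) \<in> E" by blast
    then have "u \<noteq> v" using assms(2) by (auto simp: irrefl_def)
    then have cV: "card V = card (V - {u, v}) + 2"
      using uv Suc.prems card_Diff_subset[of "{u, v}" V] card_mono[of V "{u, v}"] by auto
    from Suc.IH[of "V - {u, v}"] Suc.prems
    consider (few) "4 ^ k * card (indep E (V - {u, v})) \<le> 3 ^ k * 2 ^ card (V - {u, v})"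
      | (cover) C where "C \<subseteq> V - {u, v}" "card C \<le> 2 * k"
          "\<forall>x\<in>V - {u, v} - C. \<forall>y\<in>V - {u, v} - C. (x, y) \<notin> E"
      by auto
    then show ?thesis
    proof cases
      case few
      have "4 ^ Suc k * card (indep E V) \<le> 4 ^ Suc k * (3 * card (indep E (V - {u, v})))"
        using card_indep_remove_edge[OF Suc.prems uv] by simp
      also have "\<dots> = 12 * (4 ^ k * card (indep E (V - {u, v})))" by simp
      also have "\<dots> \<le> 12 * (3 ^ k * 2 ^ card (V - {u, v}))" using few by simp
      also have "\<dots> = 3 ^ Suc k * 2 ^ card V" by (simp add: cV)
      finally show ?thesis by blast
    next
      case cover
      have "C \<union> {u, v} \<subseteq> V" using cover uv by auto
      moreover have "card (C \<union> {u, v}) \<le> 2 * Suc k"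
        using card_Un_le[of C "{u, v}"] cover \<open>u \<noteq> v\<close> by simp
      moreover have "\<forall>x\<in>V - (C \<union> {u, v}). \<forall>y\<in>V - (C \<union> {u, v}). (x, y) \<notin> E"
        using cover(3) by blast
      ultimately show ?thesis by blast
    qed
  qed
qed

text \<open>
  The sum from \<open>card_indep_split\<close> when the core consists of \<open>c\<close> vertices numbered from \<open>0\<close>:
  \<open>\<I>\<close> plays the role of the family of independent core sets, and \<open>m T\<close> is the number of outer
  vertices whose neighbourhood in the core is \<open>T\<close>.
\<close>
definition cover_value :: "nat \<Rightarrow> nat set set \<times> (nat set \<Rightarrow> nat) \<Rightarrow> nat" where
  "cover_value c = (\<lambda>(\<I>, m). \<Sum>S\<in>\<I>. 2 ^ (\<Sum>T\<in>{T \<in> Pow {..<c}. T \<inter> S = {}}. m T))"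

lemma card_indep_small_cover:
  assumes fin: "finite V" and sy: "sym E" and C: "C \<subseteq> V" "card C \<le> c"
    and ind: "\<forall>u\<in>V - C. \<forall>v\<in>V - C. (u, v) \<notin> E"
  shows "card (indep E V) \<in> cover_value c ` (Pow (Pow {..<c}) \<times> (Pow {..<c} \<rightarrow>\<^sub>E {..card V}))"
proof -
  have finC: "finite C" using C fin finite_subset by blast
  \<comment> \<open>Numbering \<open>C\<close> turns its sets and types into data from a pool that depends on \<open>c\<close> only.\<close>
  obtain f where f: "f ` C \<subseteq> {..<c}" "inj_on f C"
    using card_le_inj[OF finC, of "{..<c}"] C by auto
  let ?U = "V - C"
  define \<tau> where "\<tau> u = f ` {v \<in> C. (v, u) \<in> E}" for u
  define m where "m = (\<lambda>T\<in>Pow {..<c}. card {u \<in> ?U. \<tau> u = T})"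
  define \<I> where "\<I> = (`) f ` indep E C"
  have inj: "inj_on ((`) f) (indep E C)"
    using inj_on_image_Pow[OF f(2)] by (rule inj_on_subset) (auto simp: indep_def)
  have eq: "card {u \<in> ?U. \<forall>v\<in>S. (v, u) \<notin> E} = (\<Sum>T\<in>{T \<in> Pow {..<c}. T \<inter> f ` S = {}}. m T)"
    if S: "S \<in> indep E C" for S
  proof -
    have non_adj: "(\<forall>v\<in>S. (v, u) \<notin> E) \<longleftrightarrow> \<tau> u \<inter> f ` S = {}" for u
      using S f(2) by (fastforce simp: \<tau>_def indep_def inj_on_def)
    have \<tau>_sub: "\<tau> u \<subseteq> {..<c}" for u using f(1) by (auto simp: \<tau>_def)
    have "{u \<in> ?U. \<forall>v\<in>S. (v, u) \<notin> E}
        = (\<Union>T\<in>{T \<in> Pow {..<c}. T \<inter> f ` S = {}}. {u \<in> ?U. \<tau> u = T})"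
      unfolding non_adj using \<tau>_sub by blast
    also have "card \<dots> = (\<Sum>T\<in>{T \<in> Pow {..<c}. T \<inter> f ` S = {}}. card {u \<in> ?U. \<tau> u = T})"
      by (rule card_UN_disjoint) (use fin in auto)
    also have "\<dots> = (\<Sum>T\<in>{T \<in> Pow {..<c}. T \<inter> f ` S = {}}. m T)"
      by (rule sum.cong) (auto simp: m_def)
    finally show ?thesis .
  qed
  have "card (indep E V) = card (indep E (C \<union> ?U))" using C by (simp add: Un_absorb1)
  also have "\<dots> = (\<Sum>S\<in>indep E C. 2 ^ card {u \<in> ?U. \<forall>v\<in>S. (v, u) \<notin> E})"
    by (rule card_indep_split) (use finC fin sy ind in auto)
  also have "\<dots> = (\<Sum>S\<in>indep E C. 2 ^ (\<Sum>T\<in>{T \<in> Pow {..<c}. T \<inter> f ` S = {}}. m T))"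
    by (rule sum.cong) (simp_all only: eq)
  also have "\<dots> = cover_value c (\<I>, m)"
    by (simp add: cover_value_def \<I>_def sum.reindex[OF inj])
  finally have "card (indep E V) = cover_value c (\<I>, m)" .
  moreover have "\<I> \<in> Pow (Pow {..<c})" using f(1) by (fastforce simp: \<I>_def indep_def)
  moreover have "m \<in> Pow {..<c} \<rightarrow>\<^sub>E {..card V}"
  proof -
    have "card {u \<in> ?U. \<tau> u = T} \<le> card V" for T
      by (rule card_mono) (use fin in auto)
    then show ?thesis by (auto simp: m_def)
  qed
  ultimately show ?thesis by blast
qed

text \<open>
  A value is either at most \<open>(3/4) ^ k * 2 ^ n\<close>, or it comes from a cover of at most \<open>2 * k\<close>
  vertices. In the second case there are \<open>2 ^ 4 ^ k\<close> families of subsets of the cover and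
  \<open>(n + 1) ^ 4 ^ k\<close> ways to count the vertices of each type.
\<close>
lemma Ni_le_nat:
  "4 ^ k * Ni n \<le> 3 ^ k * 2 ^ n + 4 ^ k * (1 + (2 * (n + 1)) ^ (4 ^ k))"
proof -
  define M :: nat where "M = 3 ^ k * 2 ^ n div 4 ^ k"
  define D where "D = Pow (Pow {..<2 * k}) \<times> (Pow {..<2 * k} \<rightarrow>\<^sub>E {..n})"
  have finD: "finite D" by (auto simp: D_def intro!: finite_PiE)
  have pow: "card (Pow {..<2 * k}) = 4 ^ k"
    by (simp add: card_Pow power_mult)
  have "card D = 2 ^ (4 ^ k) * (n + 1) ^ (4 ^ k)"
    unfolding D_def by (simp add: card_cartesian_product card_PiE card_Pow power_mult)
  then have card_D: "card D = (2 * (n + 1)) ^ (4 ^ k)"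
    by (simp only: power_mult_distrib)
  have "num_indep ` graphs_of_order n \<subseteq> {..M} \<union> cover_value (2 * k) ` D"
  proof
    fix x assume "x \<in> num_indep ` graphs_of_order n"
    then obtain G where "G \<in> graphs_of_order n" and x: "x = num_indep G" by blast
    then have G: "pair_graph G" "card (pverts G) = n" by (simp_all add: graphs_of_order_def)
    interpret pair_graph G by fact
    have sy: "sym (parcs G)"
      using pair_sym_arcs by (simp add: symmetric_def)
    have irr: "irrefl (parcs G)"
      using pair_no_loops by (fastforce simp: irrefl_def)
    have fin: "finite (pverts G)" by (rule pair_finite_verts)
    from few_indep_or_small_cover[OF fin irr, of k]
    show "x \<in> {..M} \<union> cover_value (2 * k) ` D"
    proof (elim disjE exE conjE)
      assume "4 ^ k * card (indep (parcs G) (pverts G)) \<le> 3 ^ k * 2 ^ card (pverts G)"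
      then have "x \<le> M"
        using G x by (simp add: M_def num_indep_eq less_eq_div_iff_mult_less_eq mult.commute)
      then show ?thesis by simp
    next
      fix C assume "C \<subseteq> pverts G" "card C \<le> 2 * k"
        "\<forall>u\<in>pverts G - C. \<forall>v\<in>pverts G - C. (u, v) \<notin> parcs G"
      from card_indep_small_cover[OF fin sy this]
      show ?thesis using G x by (simp add: num_indep_eq D_def)
    qed
  qed
  then have "Ni n \<le> card ({..M} \<union> cover_value (2 * k) ` D)"
    unfolding Ni_def by (intro card_mono) (use finD in auto)
  also have "\<dots> \<le> card {..M} + card (cover_value (2 * k) ` D)" by (rule card_Un_le)
  also have "\<dots> \<le> Suc M + card D" using card_image_le[OF finD] by simp
  finally have "Ni n \<le> M + (1 + (2 * (n + 1)) ^ (4 ^ k))"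
    using card_D by simp
  then have "4 ^ k * Ni n \<le> 4 ^ k * M + 4 ^ k * (1 + (2 * (n + 1)) ^ (4 ^ k))"
    by (metis mult_le_mono2 distrib_left)
  also have "4 ^ k * M \<le> 3 ^ k * 2 ^ n" by (simp add: M_def)
  finally show ?thesis by simp
qed

lemma Ni_le:
  "real (Ni n) \<le> (3/4) ^ k * 2 ^ n + 1 + (2 * (real n + 1)) ^ (4 ^ k)"
proof -
  have "real (4 ^ k * Ni n) \<le> real (3 ^ k * 2 ^ n + 4 ^ k * (1 + (2 * (n + 1)) ^ (4 ^ k)))"
    using Ni_le_nat[of k n] by (simp only: of_nat_le_iff)
  then have "4 ^ k * real (Ni n) \<le> 4 ^ k * ((3/4) ^ k * 2 ^ n + 1 + (2 * (real n + 1)) ^ (4 ^ k))"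
    by (simp add: power_divide algebra_simps)
  then show ?thesis by simp
qed

text \<open>
  The exponent \<open>0.2075\<close> is so close to \<open>log 2 (4/3) / 2\<close> that a good rational bound is required;
  \<open>485 / 306\<close> is a convergent of the continued fraction of \<open>log 2 3\<close>, from above.
\<close>
lemma log2_four_thirds_ge: "127 / 306 \<le> log 2 (4 / 3 :: real)"
proof -
  have "306 * log 2 3 = log 2 (3 ^ 306 :: real)"
    using log_nat_power[of 3 2 306] by (simp only: of_nat_numeral zero_le_numeral)
  also have "\<dots> \<le> log 2 (2 ^ 485)" by (subst log_le_cancel_iff) simp_all
  also have "\<dots> = 485" by (subst log_pow_cancel) simp_all
  finally have "306 * log 2 3 \<le> (485 :: real)" .
  moreover have "log 2 (4 / 3 :: real) = 2 - log 2 3"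
    using log_nat_power[of 2 2 2] by (simp add: log_divide)
  ultimately show ?thesis by simp
qed

text \<open>
  The choice \<open>k \<approx> 0.99993 * log 2 n / 2\<close> makes \<open>4 ^ k\<close> at most \<open>n powr 0.99993\<close>. The factor
  \<open>0.99993\<close> is below \<open>1\<close>, which keeps the second term negligible, yet large enough that
  \<open>0.99993 / 2 * (127 / 306) \<ge> 0.2075\<close>. Rounding \<open>k\<close> down costs the factor \<open>4 / 3\<close>.
\<close>
lemma Ni_le_powr:
  assumes n: "n \<ge> 1"
  shows "real (Ni n) \<le> 4 / 3 * (2 ^ n * real n powr (- 0.2075))
    + (1 + (2 * (real n + 1)) powr (real n powr 0.99993))"
proof -
  define x where "x = 0.99993 / 2 * log 2 (real n)"
  have x0: "x \<ge> 0" using n by (simp add: x_def)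
  define k where "k = nat \<lfloor>x\<rfloor>"
  have k: "real k \<le> x" "x - 1 \<le> real k" using x0 by (auto simp: k_def)
  have "(3/4 :: real) ^ k = (3/4) powr real k" by (simp add: powr_realpow)
  also have "\<dots> \<le> (3/4) powr (x - 1)" by (rule powr_mono') (use k in auto)
  also have "\<dots> = 4 / 3 * (3/4) powr x" by (simp add: powr_diff)
  also have "(3/4 :: real) powr x \<le> real n powr (- 0.2075)"
  proof -
    have "(3/4 :: real) = 2 powr (- log 2 (4/3))"
      by (simp add: powr_minus powr_log_cancel)
    then have "(3/4 :: real) powr x = 2 powr (- log 2 (4/3) * x)"
      by (simp only: powr_powr)
    also have "\<dots> \<le> 2 powr (- (127/306) * x)"
      using mult_right_mono[OF log2_four_thirds_ge x0] by (intro powr_mono) simp_all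
    also have "- (127/306) * x \<le> - 0.2075 * log 2 (real n)"
      using n by (simp add: x_def)
    then have "2 powr (- (127/306) * x) \<le> 2 powr (- 0.2075 * log 2 (real n))"
      by (rule powr_mono) simp
    also have "\<dots> = (2 powr log 2 (real n)) powr (- 0.2075)"
      by (simp add: powr_powr mult.commute)
    also have "\<dots> = real n powr (- 0.2075)" using n by simp
    finally show ?thesis .
  qed
  finally have 1: "(3/4) ^ k \<le> 4 / 3 * real n powr (- 0.2075)" by simp
  have "real (4 ^ k) = 4 powr real k" by (simp add: powr_realpow)
  also have "\<dots> \<le> 4 powr x" by (rule powr_mono) (use k in auto)
  also have "\<dots> = (2 powr 2) powr x" by simp
  also have "\<dots> = 2 powr (log 2 (real n) * 0.99993)"
    unfolding powr_powr by (simp add: x_def mult.commute)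
  also have "\<dots> = (2 powr log 2 (real n)) powr 0.99993"
    by (simp only: powr_powr)
  also have "\<dots> = real n powr 0.99993" using n by simp
  finally have 2: "real (4 ^ k) \<le> real n powr 0.99993" .
  have "(2 * (real n + 1)) ^ (4 ^ k) = (2 * (real n + 1)) powr real (4 ^ k)"
    by (rule powr_realpow[symmetric]) simp
  also have "\<dots> \<le> (2 * (real n + 1)) powr (real n powr 0.99993)"
    by (rule powr_mono[OF 2]) simp
  finally have 3: "(2 * (real n + 1)) ^ (4 ^ k) \<le> (2 * (real n + 1)) powr (real n powr 0.99993)" .
  have "(3/4) ^ k * 2 ^ n \<le> 4 / 3 * real n powr (- 0.2075) * 2 ^ n"
    by (rule mult_right_mono[OF 1]) simp
  also have "\<dots> = 4 / 3 * (2 ^ n * real n powr (- 0.2075))" by simp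
  finally show ?thesis using Ni_le[of n k] 3 by linarith
qed

lemma Ni_upper_bound:
  "\<exists>C::real. C > 0 \<and> (\<forall>n\<ge>1. real (Ni n) \<le> C * (2 ^ n * real n powr (- 0.2075)))"
proof -
  have "eventually (\<lambda>n. 1 + (2 * (real n + 1)) powr (real n powr 0.99993)
      \<le> 2 powr real n * real n powr (- 0.2075)) at_top"
    by real_asymp
  then obtain n0 where n0: "\<And>n. n \<ge> n0 \<Longrightarrow> 1 + (2 * (real n + 1)) powr (real n powr 0.99993)
      \<le> 2 powr real n * real n powr (- 0.2075)"
    by (auto simp: eventually_at_top_linorder)
  define C where "C = max 3 (2 * real n0 powr 0.2075)"
  have "real (Ni n) \<le> C * (2 ^ n * real n powr (- 0.2075))" if n: "n \<ge> 1" for n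
  proof (cases "n \<ge> n0")
    case True
    then have "real (Ni n) \<le> 3 * (2 ^ n * real n powr (- 0.2075))"
      using Ni_le_powr[OF n] n0[OF True] by (simp add: powr_realpow)
    also have "\<dots> \<le> C * (2 ^ n * real n powr (- 0.2075))"
      by (rule mult_right_mono) (auto simp: C_def)
    finally show ?thesis .
  next
    case False
    have "Ni n \<le> card {..(2::nat) ^ n}"
      unfolding Ni_def by (rule card_mono) (auto intro: num_indep_le)
    also have "card {..(2::nat) ^ n} = 2 ^ n + 1" by simp
    finally have "real (Ni n) \<le> real (2 ^ n + 1)" by (simp only: of_nat_le_iff)
    then have "real (Ni n) \<le> 2 ^ n + 1" by simp
    also have "\<dots> \<le> 2 * 2 ^ n" using one_le_power[of "2::real" n] by simp
    also have "\<dots> \<le> 2 * 2 ^ n * (real n0 powr 0.2075 * real n powr (- 0.2075))"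
    proof -
      have "real n powr 0.2075 \<le> real n0 powr 0.2075"
        by (rule powr_mono2) (use False in auto)
      then have "1 \<le> real n0 powr 0.2075 * real n powr (- 0.2075)"
        using n by (simp add: powr_minus field_simps)
      then show ?thesis by simp
    qed
    also have "\<dots> = 2 * real n0 powr 0.2075 * (2 ^ n * real n powr (- 0.2075))" by simp
    also have "\<dots> \<le> C * (2 ^ n * real n powr (- 0.2075))"
      by (rule mult_right_mono) (auto simp: C_def)
    finally show ?thesis .
  qed
  moreover have "C > 0" by (simp add: C_def)
  ultimately show ?thesis by blast
qed

section \<open>A core that addresses switches\<close>

text \<open>
  The core \<open>K\<close> carries the conflict relation \<open>F\<close>, the outer vertices \<open>U\<close> are independent, and
  \<open>P v u\<close> says that \<open>v\<close> and \<open>u\<close> are not adjacent. Any \<open>P\<close> whatsoever gives a graph, which is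
  the freedom that the construction exploits.
\<close>
lemma core_sum_attained:
  fixes K :: "'a set" and U :: "'b set"
  assumes fin: "finite K" "finite U" and F: "sym F" "irrefl F"
  shows "(\<Sum>S\<in>indep F K. 2 ^ card {u \<in> U. \<forall>v\<in>S. P v u})
    \<in> num_indep ` graphs_of_order (card K + card U)"
proof -
  define E :: "('a + 'b) rel" where "E = {(Inl v, Inl w) |v w. (v, w) \<in> F}
    \<union> {(Inl v, Inr u) |v u. \<not> P v u} \<union> {(Inr u, Inl v) |v u. \<not> P v u}"
  have E: "(Inl v, Inl w) \<in> E \<longleftrightarrow> (v, w) \<in> F" "(Inl v, Inr u) \<in> E \<longleftrightarrow> \<not> P v u"
    "(Inr u, Inr u') \<notin> E" for v w u u'
    by (auto simp: E_def)
  have E_sym: "sym E" using F(1) by (auto simp: E_def sym_def)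
  have E_irr: "irrefl E" using F(2) by (auto simp: E_def irrefl_def)
  have ind: "indep E (Inl ` K) = (`) Inl ` indep F K"
  proof (intro equalityI subsetI)
    fix S assume S: "S \<in> indep E (Inl ` K)"
    then obtain S' where "S = Inl ` S'" "S' \<subseteq> K" by (auto simp: indep_def subset_image_iff)
    with S show "S \<in> (`) Inl ` indep F K" by (auto simp: indep_def E)
  qed (auto simp: indep_def E)
  have "card (indep E (Inl ` K \<union> Inr ` U))
      = (\<Sum>S\<in>indep E (Inl ` K). 2 ^ card {u \<in> Inr ` U. \<forall>v\<in>S. (v, u) \<notin> E})"
    by (rule card_indep_split) (use fin E_sym in \<open>auto simp: E\<close>)
  also have "\<dots> = (\<Sum>S\<in>indep F K. 2 ^ card {u \<in> Inr ` U. \<forall>v\<in>Inl ` S. (v, u) \<notin> E})"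
    unfolding ind by (subst sum.reindex) (auto simp: inj_on_def inj_image_eq_iff)
  also have "\<dots> = (\<Sum>S\<in>indep F K. 2 ^ card {u \<in> U. \<forall>v\<in>S. P v u})"
  proof (rule sum.cong)
    fix S
    have "{u \<in> Inr ` U. \<forall>v\<in>Inl ` S. (v, u) \<notin> E} = Inr ` {u \<in> U. \<forall>v\<in>S. P v u}"
      by (auto simp: E)
    then show "(2::nat) ^ card {u \<in> Inr ` U. \<forall>v\<in>Inl ` S. (v, u) \<notin> E} = 2 ^ card {u \<in> U. \<forall>v\<in>S. P v u}"
      by (simp add: card_image)
  qed simp
  finally have "card (indep E (Inl ` K \<union> Inr ` U)) = (\<Sum>S\<in>indep F K. 2 ^ card {u \<in> U. \<forall>v\<in>S. P v u})" .
  moreover have "card (Inl ` K \<union> Inr ` U) = card K + card U"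
    using fin by (subst card_Un_disjoint) (auto simp: card_image)
  ultimately show ?thesis
    using relabel_graph[OF _ E_sym E_irr, of "Inl ` K \<union> Inr ` U"] fin by simp
qed

text \<open>
  The cancellation in pairs: an involution that negates \<open>P\<close> shows that \<open>P\<close> holds on exactly half of
  \<open>W\<close>, a number that does not depend on \<open>P\<close>.
\<close>
lemma card_flipped_half:
  assumes fin: "finite W" and inv: "\<And>Y. Y \<in> W \<Longrightarrow> \<tau> Y \<in> W" "\<And>Y. Y \<in> W \<Longrightarrow> \<tau> (\<tau> Y) = Y"
    and flip: "\<And>Y. Y \<in> W \<Longrightarrow> P (\<tau> Y) \<longleftrightarrow> \<not> P Y"
  shows "2 * card {Y \<in> W. P Y} = card W"
proof -
  have "bij_betw \<tau> {Y \<in> W. P Y} {Y \<in> W. \<not> P Y}"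
    by (rule bij_betwI[where g = \<tau>]) (use inv flip in auto)
  then have "card {Y \<in> W. P Y} = card {Y \<in> W. \<not> P Y}" by (rule bij_betw_same_card)
  moreover have "card W = card ({Y \<in> W. P Y} \<union> {Y \<in> W. \<not> P Y})"
    by (rule arg_cong[where f = card]) auto
  moreover have "\<dots> = card {Y \<in> W. P Y} + card {Y \<in> W. \<not> P Y}"
    by (rule card_Un_disjoint) (use fin in auto)
  ultimately show ?thesis by simp
qed

text \<open>
  Throughout, digits are numbered \<open>0, ..., R * (R + 1)\<close> and a number is identified with the set of
  positions of its binary digits \<open>1\<close>. The digits below \<open>h\<close> fall into the blocks \<open>0, ..., R\<close> of
  at most \<open>R\<close> digits each.
\<close>
definition block :: "nat \<Rightarrow> nat \<Rightarrow> nat \<Rightarrow> nat set" where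
  "block R h t = {k. k < h \<and> k div R = t}"

text \<open>
  There are \<open>2 ^ k\<close> outer vertices \<open>(k, Y)\<close> for each digit \<open>k\<close>: they stand for the value of that
  digit. The sets \<open>Y\<close> only matter to the core with \<open>h = k\<close>, see \<open>compatible\<close> below.
\<close>
definition outer :: "nat \<Rightarrow> (nat \<times> nat set) set" where
  "outer R = (SIGMA k:{..R * (R + 1)}. Pow {..<k})"

text \<open>
  The vertex \<open>(h, t, X)\<close> belongs to the \<open>h\<close>-th of the cores, one for each \<open>h\<close> from \<open>R\<close> to
  \<open>R * (R + 1)\<close>, and there to the clique of block \<open>t\<close>; it says that this block has content \<open>X\<close>.
\<close>
definition core :: "nat \<Rightarrow> (nat \<times> nat \<times> nat set) set" where
  "core R = (SIGMA h:{R..R * (R + 1)}. SIGMA t:{..R}. Pow (block R h t))"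

definition conflict :: "(nat \<times> nat \<times> nat set) rel" where
  "conflict = {((h, t, X), (h', t', X')). h \<noteq> h' \<or> (t = t' \<and> X \<noteq> X')}"

text \<open>
  The switch \<open>(h, X)\<close> stands for the position \<open>X \<union> {h<..R * (R + 1)}\<close>, in which \<open>h\<close> is the
  highest digit \<open>0\<close> and \<open>X\<close> gives the digits below. All positions occur once in this way except
  the \<open>2 ^ R\<close> ones whose digits from \<open>R\<close> on are all \<open>1\<close>.
\<close>
definition switches :: "nat \<Rightarrow> (nat \<times> nat set) set" where
  "switches R = (SIGMA h:{R..R * (R + 1)}. Pow {..<h})"

text \<open>
  The core vertex \<open>(h, t, X)\<close> and the outer vertex \<open>(k, Y)\<close> are not adjacent; \<open>B\<close> is the set of
  switches that are on. Digits \<open>k\<close> above \<open>h\<close> count as \<open>1\<close>, hence no edges. A digit \<open>k\<close> below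
  \<open>h\<close> is decided by the clique of its block.

  The \<open>2 ^ h\<close> outer vertices with \<open>k = h\<close> implement the switches of this core. Such a \<open>Y\<close> is
  read in two parts: its digits \<open>t - 1 < R\<close> name a set of cliques \<open>t\<close> out of \<open>1, ..., R\<close>, and
  its digits from \<open>R\<close> on are the contents that these cliques should have. A vertex of clique \<open>t > 0\<close>
  leaves \<open>(h, Y)\<close> free only if \<open>t\<close> is named by \<open>Y\<close> and its content agrees with \<open>Y\<close>. A
  vertex of clique \<open>0\<close> completes the contents in \<open>Y\<close> to a switch. It leaves \<open>(h, Y)\<close> free if
  the number of cliques that \<open>Y\<close> does not name is even and the switch is on, or that number is odd
  and the switch is off. The summand \<open>R\<close> adjusts the parity so that, when all \<open>R\<close> cliques are
  named, free means on.
\<close>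
fun compatible :: "nat \<Rightarrow> (nat \<times> nat set) set \<Rightarrow> nat \<times> nat \<times> nat set \<Rightarrow> nat \<times> nat set \<Rightarrow> bool" where
  "compatible R B (h, t, X) (k, Y) \<longleftrightarrow>
    (if k > h then True
     else if k < h then k div R = t \<longrightarrow> k \<in> X
     else if t = 0 then even (card (Y \<inter> {..<R}) + R) \<longleftrightarrow> (h, X \<union> Y \<inter> {R..<h}) \<in> B
     else t - 1 \<in> Y \<and> Y \<inter> block R h t = X)"

definition free :: "nat \<Rightarrow> (nat \<times> nat set) set \<Rightarrow> (nat \<times> nat \<times> nat set) set \<Rightarrow> (nat \<times> nat set) set" where
  "free R B S = {u \<in> outer R. \<forall>c\<in>S. compatible R B c u}"

definition transversal :: "nat \<Rightarrow> nat \<times> nat set \<Rightarrow> (nat \<times> nat \<times> nat set) set" where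
  "transversal R = (\<lambda>(h, X). (\<lambda>t. (h, t, X \<inter> block R h t)) ` {..R})"

definition exponent :: "nat \<Rightarrow> nat \<times> nat set \<Rightarrow> nat" where
  "exponent R = (\<lambda>(h, X). set_encode (X \<union> {h<..R * (R + 1)}))"

lemma finite_outer [simp]: "finite (outer R)"
  by (simp add: outer_def)

lemma finite_block [simp]: "finite (block R h t)"
  by (rule finite_subset[of _ "{..<h}"]) (auto simp: block_def)

lemma finite_core [simp]: "finite (core R)"
  by (simp add: core_def)

lemma finite_switches [simp]: "finite (switches R)"
  by (simp add: switches_def)

lemma sym_conflict: "sym conflict"
  by (auto simp: conflict_def sym_def)

lemma irrefl_conflict: "irrefl conflict"
  by (auto simp: conflict_def irrefl_def)

lemma sum_pow2_atMost: "(\<Sum>k\<le>m. 2 ^ k) = (2 ^ (m + 1) - 1 :: nat)"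
  by (induction m) auto

lemma card_outer: "card (outer R) = 2 ^ (R * (R + 1) + 1) - 1"
  unfolding outer_def by (simp add: card_SigmaI card_Pow sum_pow2_atMost del: mult_Suc_right)

lemma card_switches: "card (switches R) + 2 ^ R = 2 ^ (R * (R + 1) + 1)"
proof -
  have *: "(\<Sum>h = R..m. 2 ^ h) + 2 ^ R = (2 ^ (m + 1) :: nat)" if "R \<le> m" for m
    using that by (induction m rule: dec_induct) auto
  have "card (switches R) = (\<Sum>h = R..R * (R + 1). 2 ^ h)"
    unfolding switches_def by (subst card_SigmaI) (auto simp: card_Pow)
  with *[of "R * (R + 1)"] show ?thesis by simp
qed

lemma card_block_le: "R > 0 \<Longrightarrow> card (block R h t) \<le> R"
proof -
  assume R: "R > 0"
  have "block R h t \<subseteq> {t * R..<t * R + R}"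
  proof
    fix k assume "k \<in> block R h t"
    then have "k = t * R + k mod R" by (auto simp: block_def)
    moreover have "k mod R < R" using R by simp
    ultimately show "k \<in> {t * R..<t * R + R}" by (metis atLeastLessThan_iff le_add1 nat_add_left_cancel_less)
  qed
  then show ?thesis using card_mono[of "{t * R..<t * R + R}"] by simp
qed

lemma card_core_le:
  assumes "R > 0"
  shows "card (core R) \<le> (R * R + 1) * ((R + 1) * 2 ^ R)"
proof -
  have "card (core R) = (\<Sum>h = R..R * (R + 1). \<Sum>t\<le>R. 2 ^ card (block R h t))"
    unfolding core_def by (subst card_SigmaI; simp add: card_SigmaI card_Pow)
  also have "\<dots> \<le> (\<Sum>h = R..R * (R + 1). \<Sum>t\<le>R. 2 ^ R)"
    by (intro sum_mono power_increasing card_block_le assms) auto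
  also have "\<dots> = (R * R + 1) * ((R + 1) * 2 ^ R)" by (simp add: algebra_simps)
  finally show ?thesis .
qed

lemma block_cover:
  assumes "R > 0" "h \<le> R * (R + 1)"
  shows "(\<Union>t\<le>R. block R h t) = {..<h}"
proof -
  have "k div R \<le> R" if "k < h" for k
  proof -
    have "k < (R + 1) * R" using that assms(2) by (simp add: mult.commute)
    then have "k div R < R + 1" using assms(1) by (simp add: less_mult_imp_div_less)
    then show ?thesis by simp
  qed
  then show ?thesis by (auto simp: block_def)
qed

text \<open>
  A digit \<open>k\<close> of the position contributes all of its \<open>2 ^ k\<close> outer vertices. Among the outer
  vertices with \<open>k = h\<close>, only the one that names all cliques with exactly the contents \<open>X\<close> can be
  free, and clique \<open>0\<close> leaves it free precisely if the switch is on.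
\<close>
lemma free_transversal:
  assumes R: "R > 0" and hX: "(h, X) \<in> switches R"
  shows "free R B (transversal R (h, X)) = (SIGMA k:X \<union> {h<..R * (R + 1)}. Pow {..<k})
    \<union> (if (h, X) \<in> B then {(h, {..<R} \<union> X \<inter> {R..<h})} else {})" (is "_ = ?rhs")
proof -
  have h: "R \<le> h" "h \<le> R * (R + 1)" and X: "X \<subseteq> {..<h}" using hX by (auto simp: switches_def)
  have divR: "k div R \<le> R" if "k < h" for k
    using block_cover[OF R h(2)] that by (auto simp: block_def)
  have X0: "X \<inter> block R h 0 = X \<inter> {..<R}"
    using R h by (auto simp: block_def div_eq_0_iff)
  have mem: "(k, Y) \<in> free R B (transversal R (h, X)) \<longleftrightarrow>
      (k, Y) \<in> outer R \<and> (\<forall>t\<le>R. compatible R B (h, t, X \<inter> block R h t) (k, Y))" for k Y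
    by (auto simp: free_def transversal_def simp del: compatible.simps)
  have "(k, Y) \<in> free R B (transversal R (h, X)) \<longleftrightarrow> (k, Y) \<in> ?rhs" for k Y
  proof -
    consider "k > h" | "k < h" | "k = h" by linarith
    then show ?thesis
    proof cases
      case 1
      then show ?thesis using X unfolding mem by (auto simp: outer_def)
    next
      case 2
      have "(\<forall>t\<le>R. compatible R B (h, t, X \<inter> block R h t) (k, Y)) \<longleftrightarrow> k \<in> X"
        using 2 divR[OF 2] by (auto simp: block_def)
      then show ?thesis using 2 h unfolding mem by (auto simp: outer_def)
    next
      case 3
      let ?Y = "{..<R} \<union> X \<inter> {R..<h}"
      \<comment> \<open>The two halves of the condition imposed by the cliques \<open>t > 0\<close> determine \<open>Y\<close>.\<close>
      have low: "(\<forall>t\<in>{1..R}. t - 1 \<in> Y) \<longleftrightarrow> {..<R} \<subseteq> Y"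
      proof
        assume *: "\<forall>t\<in>{1..R}. t - 1 \<in> Y"
        show "{..<R} \<subseteq> Y"
        proof
          fix k assume "k \<in> {..<R}"
          then show "k \<in> Y" using *[rule_format, of "Suc k"] by simp
        qed
      qed (auto simp: subset_iff)
      have high: "(\<forall>t\<in>{1..R}. Y \<inter> block R h t = X \<inter> block R h t) \<longleftrightarrow> Y \<inter> {R..<h} = X \<inter> {R..<h}"
      proof -
        have "{R..<h} = (\<Union>t\<in>{1..R}. block R h t)"
          using divR R by (auto simp: block_def Suc_le_eq div_greater_zero_iff)
        moreover have "block R h t \<subseteq> {R..<h}" if "t \<in> {1..R}" for t
          using that calculation by blast
        ultimately show ?thesis by blast
      qed
      have "(\<forall>t\<le>R. compatible R B (h, t, X \<inter> block R h t) (h, Y)) \<longleftrightarrow>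
          compatible R B (h, 0, X \<inter> block R h 0) (h, Y)
          \<and> (\<forall>t\<in>{1..R}. compatible R B (h, t, X \<inter> block R h t) (h, Y))"
        by (metis atLeastAtMost_iff le0 less_one linorder_not_le)
      also have "(\<forall>t\<in>{1..R}. compatible R B (h, t, X \<inter> block R h t) (h, Y))
          \<longleftrightarrow> (\<forall>t\<in>{1..R}. t - 1 \<in> Y) \<and> (\<forall>t\<in>{1..R}. Y \<inter> block R h t = X \<inter> block R h t)"
        by auto
      also have "\<dots> \<longleftrightarrow> {..<R} \<subseteq> Y \<and> Y \<inter> {R..<h} = X \<inter> {R..<h}"
        by (simp only: low high)
      also have "compatible R B (h, 0, X \<inter> block R h 0) (h, Y) \<and> ({..<R} \<subseteq> Y \<and> Y \<inter> {R..<h} = X \<inter> {R..<h})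
          \<longleftrightarrow> (h, X) \<in> B \<and> ({..<R} \<subseteq> Y \<and> Y \<inter> {R..<h} = X \<inter> {R..<h})"
      proof -
        have "compatible R B (h, 0, X \<inter> block R h 0) (h, Y) \<longleftrightarrow> (h, X) \<in> B"
          if Y: "{..<R} \<subseteq> Y" "Y \<inter> {R..<h} = X \<inter> {R..<h}"
        proof -
          have "Y \<inter> {..<R} = {..<R}" using Y(1) by blast
          moreover have "X \<inter> {..<R} \<union> X \<inter> {R..<h} = X" using X by (auto simp: not_less)
          ultimately show ?thesis using Y(2) by (simp add: X0)
        qed
        then show ?thesis by blast
      qed
      finally have "(\<forall>t\<le>R. compatible R B (h, t, X \<inter> block R h t) (h, Y)) \<longleftrightarrow>
          (h, X) \<in> B \<and> ({..<R} \<subseteq> Y \<and> Y \<inter> {R..<h} = X \<inter> {R..<h})" .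
      moreover have "(h, Y) \<in> outer R \<and> ({..<R} \<subseteq> Y \<and> Y \<inter> {R..<h} = X \<inter> {R..<h}) \<longleftrightarrow> Y = ?Y"
      proof
        assume L: "(h, Y) \<in> outer R \<and> ({..<R} \<subseteq> Y \<and> Y \<inter> {R..<h} = X \<inter> {R..<h})"
        then have "Y \<subseteq> {..<h}" by (auto simp: outer_def)
        then have "Y \<subseteq> {..<R} \<union> Y \<inter> {R..<h}" by (auto simp: not_less)
        with L show "Y = ?Y" by blast
      next
        assume Y: "Y = ?Y"
        have "?Y \<inter> {R..<h} = X \<inter> {R..<h}" "?Y \<subseteq> {..<h}" using h by auto
        moreover have "(h, ?Y) \<in> outer R" using h calculation(2) by (simp add: outer_def)
        ultimately show "(h, Y) \<in> outer R \<and> ({..<R} \<subseteq> Y \<and> Y \<inter> {R..<h} = X \<inter> {R..<h})"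
          unfolding Y by blast
      qed
      moreover have "h \<notin> X" using X by auto
      ultimately show ?thesis using 3 unfolding mem by auto
    qed
  qed
  then show ?thesis by (simp only: set_eq_iff split_paired_All simp_thms)
qed

lemma card_free_transversal:
  assumes R: "R > 0" and hX: "(h, X) \<in> switches R"
  shows "card (free R B (transversal R (h, X))) = exponent R (h, X) + of_bool ((h, X) \<in> B)"
proof -
  have X: "X \<subseteq> {..<h}" using hX by (auto simp: switches_def)
  then have finX: "finite X" using finite_subset by blast
  let ?D = "SIGMA k:X \<union> {h<..R * (R + 1)}. Pow {..<k}"
  have "card ?D = (\<Sum>k\<in>X \<union> {h<..R * (R + 1)}. 2 ^ k)"
    using finX by (subst card_SigmaI) (auto simp: card_Pow)
  then have "card ?D = exponent R (h, X)"
    by (simp add: exponent_def set_encode_def)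
  moreover have "(h, Y) \<notin> ?D" for Y using X by auto
  moreover have "finite ?D" using finX by auto
  ultimately show ?thesis
    unfolding free_transversal[OF R hX] by auto
qed

text \<open>
  Only vertices of clique \<open>0\<close> look at the switches. If \<open>S\<close> contains one of them but misses some other
  clique \<open>t1\<close>, then adding \<open>t1\<close> to, or removing it from, the cliques named by \<open>Y\<close> leaves all
  conditions of the cliques \<open>t > 0\<close> and the switch in question unchanged, but flips the parity. So
  exactly half of the \<open>Y\<close> admitted by those cliques are free, whatever the switches are.
\<close>
lemma card_free_independent_of_switches:
  assumes R: "R > 0" and S: "S \<in> indep conflict (core R)" and nt: "S \<notin> transversal R ` switches R"
  shows "card (free R B S) = card (free R {} S)"
proof (cases "\<exists>h X. (h, 0, X) \<in> S")
  case False
  have "compatible R B c u = compatible R {} c u" if "c \<in> S" for c u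
    using that False by (cases c; cases u) auto
  then show ?thesis by (simp add: free_def)
next
  case True
  then obtain h X0 where X0: "(h, 0, X0) \<in> S" by blast
  have SK: "S \<subseteq> core R" and conf: "\<And>c d. c \<in> S \<Longrightarrow> d \<in> S \<Longrightarrow> (c, d) \<notin> conflict"
    using S by (auto simp: indep_def)
  have same_h: "h' = h" if "(h', t, X) \<in> S" for h' t X
    using conf[OF that X0] by (auto simp: conflict_def)
  have uniq: "X = X'" if "(h, t, X) \<in> S" "(h, t, X') \<in> S" for t X X'
    using conf[OF that] by (auto simp: conflict_def)
  have h: "R \<le> h" "h \<le> R * (R + 1)" using X0 SK by (auto simp: core_def)
  \<comment> \<open>If no clique were missed, the contents would combine to a switch that \<open>S\<close> spells out.\<close>
  have "\<exists>t1\<in>{1..R}. \<forall>X. (h, t1, X) \<notin> S"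
  proof (rule ccontr)
    assume "\<not> ?thesis"
    then have "\<exists>X. (h, t, X) \<in> S" if "t \<le> R" for t
      using that X0 by (cases "t = 0") (auto simp: Suc_le_eq)
    then obtain Z where Z: "\<And>t. t \<le> R \<Longrightarrow> (h, t, Z t) \<in> S" by metis
    define X where "X = (\<Union>t\<le>R. Z t)"
    have Zb: "Z t \<subseteq> block R h t" if "t \<le> R" for t
      using Z[OF that] SK by (auto simp: core_def)
    have "X \<inter> block R h t = Z t" if "t \<le> R" for t
    proof -
      have "Z t' \<inter> block R h t = {}" if "t' \<le> R" "t' \<noteq> t" for t'
        using Zb[OF that(1)] that(2) by (auto simp: block_def)
      then show ?thesis using Zb[OF that] that unfolding X_def by blast
    qed
    then have "transversal R (h, X) = (\<lambda>t. (h, t, Z t)) ` {..R}"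
      by (simp add: transversal_def)
    also have "\<dots> = S"
    proof (intro equalityI subsetI)
      fix c assume c: "c \<in> S"
      obtain h' t Y where c': "c = (h', t, Y)" by (cases c)
      then have "h' = h" "t \<le> R" using same_h c SK by (auto simp: core_def)
      then have "c = (h, t, Z t)" using c c' uniq Z by blast
      then show "c \<in> (\<lambda>t. (h, t, Z t)) ` {..R}" using \<open>t \<le> R\<close> by blast
    qed (use Z in auto)
    finally have "S = transversal R (h, X)" by simp
    moreover have "(h, X) \<in> switches R"
      using h Zb by (fastforce simp: switches_def X_def block_def)
    ultimately show False using nt by blast
  qed
  then obtain t1 where t1: "t1 \<in> {1..R}" "\<And>X. (h, t1, X) \<notin> S" by blast
  define j where "j = t1 - 1"
  have j: "j < R" using t1 by (auto simp: j_def)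
  \<comment> \<open>\<open>W\<close> collects the \<open>Y\<close> admitted by the cliques \<open>t > 0\<close>, \<open>P\<close> is the condition of clique \<open>0\<close>, and \<open>\<tau>\<close> toggles the missed clique.\<close>
  define W where "W = {Y. Y \<subseteq> {..<h} \<and> (\<forall>t X. t \<noteq> 0 \<longrightarrow> (h, t, X) \<in> S \<longrightarrow> t - 1 \<in> Y \<and> Y \<inter> block R h t = X)}"
  have finW: "finite W" by (rule finite_subset[of _ "Pow {..<h}"]) (auto simp: W_def)
  define P where "P B Y \<longleftrightarrow> (even (card (Y \<inter> {..<R}) + R) \<longleftrightarrow> (h, X0 \<union> Y \<inter> {R..<h}) \<in> B)"
    for B :: "(nat \<times> nat set) set" and Y
  define \<tau> where "\<tau> Y = (if j \<in> Y then Y - {j} else insert j Y)" for Y :: "nat set"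
  have half: "2 * card {Y \<in> W. P B Y} = card W" for B
  proof (rule card_flipped_half[where \<tau> = \<tau>])
    fix Y assume Y: "Y \<in> W"
    show "\<tau> (\<tau> Y) = Y" by (auto simp: \<tau>_def)
    have blk: "\<tau> Y \<inter> block R h t = Y \<inter> block R h t" if "t \<noteq> 0" for t
      using that j by (auto simp: \<tau>_def block_def)
    have mem: "t - 1 \<in> \<tau> Y" if "t \<noteq> 0" "(h, t, X) \<in> S" for t X
    proof -
      have "t \<noteq> t1" using that t1(2) by blast
      then have "t - 1 \<noteq> j" using that t1(1) by (auto simp: j_def)
      moreover have "t - 1 \<in> Y" using Y that by (auto simp: W_def)
      ultimately show ?thesis by (auto simp: \<tau>_def)
    qed
    have sub: "\<tau> Y \<subseteq> {..<h}" using Y j h by (auto simp: W_def \<tau>_def)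
    show "\<tau> Y \<in> W" using Y sub mem blk unfolding W_def by auto
    have "\<tau> Y \<inter> {R..<h} = Y \<inter> {R..<h}" using j by (auto simp: \<tau>_def)
    moreover have "even (card (\<tau> Y \<inter> {..<R})) \<longleftrightarrow> odd (card (Y \<inter> {..<R}))"
    proof (cases "j \<in> Y")
      case True
      then have "Y \<inter> {..<R} = insert j (\<tau> Y \<inter> {..<R})" "j \<notin> \<tau> Y" using j by (auto simp: \<tau>_def)
      then show ?thesis by simp
    next
      case False
      then have "\<tau> Y \<inter> {..<R} = insert j (Y \<inter> {..<R})" using j by (auto simp: \<tau>_def)
      then show ?thesis using False by simp
    qed
    ultimately show "P B (\<tau> Y) \<longleftrightarrow> \<not> P B Y" by (auto simp: P_def)
  qed (rule finW)
  define D where "D = {(k, Y) \<in> outer R. k \<noteq> h \<and> (\<forall>c\<in>S. compatible R {} c (k, Y))}"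
  have free_eq: "free R B S = D \<union> Pair h ` {Y \<in> W. P B Y}" for B
  proof -
    have "(k, Y) \<in> free R B S \<longleftrightarrow> (k, Y) \<in> D \<union> Pair h ` {Y \<in> W. P B Y}" for k Y
    proof (cases "k = h")
      case True
      have "(\<forall>c\<in>S. compatible R B c (h, Y)) \<longleftrightarrow>
          (\<forall>t X. t \<noteq> 0 \<longrightarrow> (h, t, X) \<in> S \<longrightarrow> t - 1 \<in> Y \<and> Y \<inter> block R h t = X) \<and> P B Y"
        (is "?L \<longleftrightarrow> ?M \<and> ?P")
      proof
        assume L: ?L
        have "?P" using L[rule_format, OF X0] by (simp add: P_def)
        moreover have ?M
        proof (intro allI impI)
          fix t X assume "t \<noteq> 0" "(h, t, X) \<in> S"
          then show "t - 1 \<in> Y \<and> Y \<inter> block R h t = X" using L[rule_format, of "(h, t, X)"] by simp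
        qed
        ultimately show "?M \<and> ?P" by blast
      next
        assume MP: "?M \<and> ?P"
        show ?L
        proof
          fix c assume c: "c \<in> S"
          obtain h' t X where c': "c = (h', t, X)" by (cases c)
          with c same_h have "h' = h" by blast
          with c c' uniq[OF X0] MP show "compatible R B c (h, Y)"
            by (cases "t = 0") (auto simp: P_def)
        qed
      qed
      moreover have "(h, Y) \<in> outer R \<longleftrightarrow> Y \<subseteq> {..<h}" using h by (auto simp: outer_def)
      ultimately show ?thesis using True by (auto simp: free_def D_def W_def)
    next
      case False
      have "compatible R B c (k, Y) = compatible R {} c (k, Y)" if "c \<in> S" for c
        using that same_h False by (cases c) auto
      then have "(\<forall>c\<in>S. compatible R B c (k, Y)) \<longleftrightarrow> (\<forall>c\<in>S. compatible R {} c (k, Y))" by blast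
      moreover have "(k, Y) \<in> D \<longleftrightarrow> (k, Y) \<in> outer R \<and> (\<forall>c\<in>S. compatible R {} c (k, Y))"
        using False by (simp add: D_def del: compatible.simps)
      moreover have "(k, Y) \<in> free R B S \<longleftrightarrow> (k, Y) \<in> outer R \<and> (\<forall>c\<in>S. compatible R B c (k, Y))"
        by (simp only: free_def mem_Collect_eq)
      moreover have "(k, Y) \<notin> Pair h ` A" for A using False by auto
      ultimately show ?thesis by (metis (no_types, lifting) Un_iff)
    qed
    then show ?thesis by (simp only: set_eq_iff split_paired_All simp_thms)
  qed
  have finD: "finite D" by (rule finite_subset[of _ "outer R"]) (auto simp: D_def)
  have "card (free R B S) = card D + card {Y \<in> W. P B Y}" for B
    unfolding free_eq using finD finW
    by (subst card_Un_disjoint) (auto simp: D_def card_image inj_on_def)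
  moreover have "card {Y \<in> W. P B Y} = card {Y \<in> W. P {} Y}"
    using half[of B] half[of "{}"] by simp
  ultimately show ?thesis by simp
qed

lemma transversal_indep:
  assumes "hX \<in> switches R"
  shows "transversal R hX \<in> indep conflict (core R)"
  using assms by (auto simp: switches_def transversal_def indep_def conflict_def core_def)

lemma inj_on_transversal:
  assumes R: "R > 0"
  shows "inj_on (transversal R) (switches R)"
proof (rule inj_onI)
  fix a b assume a: "a \<in> switches R" and b: "b \<in> switches R" and eq: "transversal R a = transversal R b"
  obtain h X where aX: "a = (h, X)" by (cases a)
  obtain h' X' where bX: "b = (h', X')" by (cases b)
  have "(h, 0, X \<inter> block R h 0) \<in> transversal R b"
    unfolding eq[symmetric] aX by (auto simp: transversal_def)
  then have hh: "h' = h" unfolding bX by (auto simp: transversal_def)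
  have blk: "X \<inter> block R h t = X' \<inter> block R h t" if "t \<le> R" for t
  proof -
    have "(h, t, X \<inter> block R h t) \<in> transversal R b"
      unfolding eq[symmetric] aX using that by (auto simp: transversal_def)
    then show ?thesis unfolding bX hh by (auto simp: transversal_def)
  qed
  have "h \<le> R * (R + 1)" "X \<subseteq> {..<h}" "X' \<subseteq> {..<h}"
    using a b aX bX hh by (auto simp: switches_def)
  then have "X = X'" using blk block_cover[OF R, of h] by blast
  with hh aX bX show "a = b" by simp
qed

lemma inj_on_exponent: "inj_on (exponent R) (switches R)"
proof (rule inj_onI)
  fix a b assume a: "a \<in> switches R" and b: "b \<in> switches R" and eq: "exponent R a = exponent R b"
  obtain h X where aX: "a = (h, X)" by (cases a)
  obtain h' X' where bX: "b = (h', X')" by (cases b)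
  let ?H = "R * (R + 1)"
  have X: "X \<subseteq> {..<h}" "X' \<subseteq> {..<h'}" and h: "h \<le> ?H" "h' \<le> ?H"
    using a b aX bX by (auto simp: switches_def)
  have "finite X" "finite X'" using X finite_subset by blast+
  then have Z: "X \<union> {h<..?H} = X' \<union> {h'<..?H}"
    using eq unfolding aX bX exponent_def by (simp add: set_encode_eq)
  have "\<not> h < h'"
  proof
    assume "h < h'"
    then have "h' \<in> X \<union> {h<..?H}" using h by simp
    then show False unfolding Z using X by auto
  qed
  moreover have "\<not> h' < h"
  proof
    assume "h' < h"
    then have "h \<in> X' \<union> {h'<..?H}" using h by simp
    then show False unfolding Z[symmetric] using X by auto
  qed
  ultimately have hh: "h' = h" by simp
  have "X = (X \<union> {h<..?H}) \<inter> {..<h}" using X by auto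
  also have "\<dots> = X'" using X Z hh by auto
  finally show "a = b" using aX bX hh by simp
qed

text \<open>
  Turning a switch on doubles the term \<open>2 ^ p\<close> of its position \<open>p\<close>, thus adds \<open>2 ^ p\<close>, and changes
  no other term. As the positions are distinct, the sum of these increments is the number with binary
  digits \<open>exponent R ` B\<close>.
\<close>
lemma core_sum_eq:
  assumes R: "R > 0" and B: "B \<subseteq> switches R"
  shows "(\<Sum>S\<in>indep conflict (core R). 2 ^ card (free R B S)) =
    (\<Sum>S\<in>indep conflict (core R). 2 ^ card (free R {} S)) + set_encode (exponent R ` B)"
proof -
  let ?I = "indep conflict (core R)" and ?T = "transversal R ` switches R"
  have fin: "finite ?I" by (simp add: finite_indep)
  have TI: "?T \<subseteq> ?I" using transversal_indep by blast
  have split: "(\<Sum>S\<in>?I. (2::nat) ^ card (free R B' S)) =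
      (\<Sum>S\<in>?I - ?T. 2 ^ card (free R {} S))
      + (\<Sum>s\<in>switches R. 2 ^ (exponent R s + of_bool (s \<in> B')))" for B'
  proof -
    have "(\<Sum>S\<in>?I. 2 ^ card (free R B' S)) =
        (\<Sum>S\<in>?I - ?T. 2 ^ card (free R B' S)) + (\<Sum>S\<in>?T. 2 ^ card (free R B' S))"
      using sum.subset_diff[OF TI fin] .
    also have "(\<Sum>S\<in>?I - ?T. 2 ^ card (free R B' S)) = (\<Sum>S\<in>?I - ?T. 2 ^ card (free R {} S))"
      by (rule sum.cong) (auto simp: card_free_independent_of_switches[OF R, of _ B'])
    also have "(\<Sum>S\<in>?T. 2 ^ card (free R B' S)) = (\<Sum>s\<in>switches R. 2 ^ card (free R B' (transversal R s)))"
      by (simp add: sum.reindex[OF inj_on_transversal[OF R]])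
    also have "\<dots> = (\<Sum>s\<in>switches R. 2 ^ (exponent R s + of_bool (s \<in> B')))"
      by (rule sum.cong) (auto simp: card_free_transversal[OF R])
    finally show ?thesis .
  qed
  have "(\<Sum>s\<in>switches R. (2::nat) ^ (exponent R s + of_bool (s \<in> B)))
      = (\<Sum>s\<in>switches R. 2 ^ exponent R s + (if s \<in> B then 2 ^ exponent R s else 0))"
    by (rule sum.cong) auto
  also have "\<dots> = (\<Sum>s\<in>switches R. 2 ^ exponent R s) + (\<Sum>s\<in>B. 2 ^ exponent R s)"
    using B by (simp add: sum.distrib sum.If_cases Int_absorb1)
  also have "(\<Sum>s\<in>B. 2 ^ exponent R s) = set_encode (exponent R ` B)"
    unfolding set_encode_def using inj_on_subset[OF inj_on_exponent B]
    by (simp add: sum.reindex)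
  finally show ?thesis using split[of B] split[of "{}"] by simp
qed

lemma Ni_core_outer_ge:
  assumes R: "R > 0"
  shows "2 ^ card (switches R) \<le> Ni (card (core R) + card (outer R))"
proof -
  define \<Phi> where "\<Phi> B = (\<Sum>S\<in>indep conflict (core R). 2 ^ card (free R B S) :: nat)" for B
  have "inj_on \<Phi> (Pow (switches R))"
  proof (rule inj_onI)
    fix B B' assume B: "B \<in> Pow (switches R)" "B' \<in> Pow (switches R)" and eq: "\<Phi> B = \<Phi> B'"
    then have "set_encode (exponent R ` B) = set_encode (exponent R ` B')"
      using core_sum_eq[OF R, of B] core_sum_eq[OF R, of B'] by (simp add: \<Phi>_def)
    moreover have "finite B" "finite B'" using B finite_subset[OF _ finite_switches] by auto
    ultimately have "exponent R ` B = exponent R ` B'"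
      by (simp add: set_encode_eq)
    then show "B = B'" using inj_on_image_eq_iff[OF inj_on_exponent] B by blast
  qed
  then have "2 ^ card (switches R) = card (\<Phi> ` Pow (switches R))"
    by (simp add: card_image card_Pow)
  also have "\<dots> \<le> Ni (card (core R) + card (outer R))"
    unfolding Ni_def
  proof (rule card_mono[OF finite_num_indep_image], rule image_subsetI)
    fix B
    show "\<Phi> B \<in> num_indep ` graphs_of_order (card (core R) + card (outer R))"
      unfolding \<Phi>_def free_def
      by (rule core_sum_attained) (simp_all add: sym_conflict irrefl_conflict)
  qed
  finally show ?thesis .
qed

section \<open>Lower bound\<close>

definition construction_order :: "nat \<Rightarrow> nat" where
  "construction_order R = card (core R) + card (outer R)"

text \<open>
  Compared with the order of the graph, the number of switches falls short by the core vertices and by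
  the \<open>2 ^ R\<close> positions without a switch. This deficit is \<open>2 ^ R\<close> up to a polynomial factor.
\<close>
lemma Ni_construction_order_ge:
  assumes R: "R > 0"
  shows "real (Ni (construction_order R)) \<ge> 2 powr (real (construction_order R) - 2 ^ R * (2 * (real R + 1) ^ 3))"
proof -
  let ?N = "2 ^ (R * (R + 1) + 1) :: nat"
  have "card (core R) + 2 ^ R \<le> (R * R + 1) * ((R + 1) * 2 ^ R) + 2 ^ R"
    using card_core_le[OF R] by simp
  also have "\<dots> = 2 ^ R * ((R * R + 1) * (R + 1) + 1)" by (simp add: algebra_simps)
  also have "(R * R + 1) * (R + 1) + 1 \<le> 2 * (R + 1) ^ 3"
    by (simp add: power3_eq_cube algebra_simps)
  finally have c: "card (core R) + 2 ^ R \<le> 2 ^ R * (2 * (R + 1) ^ 3)" by simp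
  have "construction_order R \<le> card (switches R) + (card (core R) + 2 ^ R)"
    using card_switches[of R] unfolding construction_order_def card_outer by linarith
  with c have "construction_order R \<le> card (switches R) + 2 ^ R * (2 * (R + 1) ^ 3)" by linarith
  then have "real (construction_order R) \<le> real (card (switches R) + 2 ^ R * (2 * (R + 1) ^ 3))"
    by (simp only: of_nat_le_iff)
  then have "real (construction_order R) - 2 ^ R * (2 * (real R + 1) ^ 3) \<le> real (card (switches R))"
    by (simp add: add.commute)
  then have "2 powr (real (construction_order R) - 2 ^ R * (2 * (real R + 1) ^ 3)) \<le> 2 powr real (card (switches R))"
    by (rule powr_mono) simp
  also have "\<dots> = real (2 ^ card (switches R))" by (simp add: powr_realpow)
  also have "\<dots> \<le> real (Ni (construction_order R))"
    using Ni_core_outer_ge[OF R] unfolding construction_order_def by (simp only: of_nat_le_iff)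
  finally show ?thesis .
qed

lemma construction_order_ge: "construction_order R \<ge> 2 ^ (R * R)"
proof -
  have "(2::nat) ^ (R * R) + 2 ^ (R * R) = 2 ^ (R * R + 1)" by simp
  also have "\<dots> \<le> 2 ^ (R * (R + 1) + 1)" by (rule power_increasing) simp_all
  finally have "(2::nat) ^ (R * R) + 2 ^ (R * R) \<le> 2 ^ (R * (R + 1) + 1)" .
  moreover have "(1::nat) \<le> 2 ^ (R * R)" by simp
  ultimately show ?thesis unfolding construction_order_def card_outer by linarith
qed

text \<open>
  The orders \<open>n\<close> of the construction satisfy \<open>R \<le> sqrt (log 2 n)\<close>, and the polynomial factor
  \<open>2 * (R + 1) ^ 3\<close> of the deficit is absorbed into the exponent: \<open>\<epsilon> n * sqrt (log 2 n)\<close> is the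
  logarithm of that factor, with \<open>R\<close> replaced by its bound.
\<close>
lemma Ni_lower_bound:
  "\<exists>(N::nat set) (\<epsilon>::nat \<Rightarrow> real). infinite N \<and> (\<forall>n\<in>N. n \<ge> 1)
    \<and> (\<epsilon> \<longlongrightarrow> 0) (inf at_top (principal N))
    \<and> (\<forall>n\<in>N. real (Ni n) \<ge> 2 powr (real n - 2 powr ((1 + \<epsilon> n) * sqrt (log 2 (real n)))))"
proof -
  define \<epsilon> where "\<epsilon> n = log 2 (2 * (sqrt (log 2 (real n)) + 1) ^ 3) / sqrt (log 2 (real n))" for n
  define N where "N = construction_order ` {1..}"
  have big: "R \<le> construction_order R" for R
  proof -
    have "R \<le> R * R" by simp
    also have "\<dots> < 2 ^ (R * R)" by (rule less_exp)
    finally show ?thesis using construction_order_ge[of R] by simp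
  qed
  have "infinite N"
    unfolding infinite_nat_iff_unbounded_le
  proof
    fix m
    show "\<exists>n\<ge>m. n \<in> N" using big[of "Suc m"] by (intro exI[of _ "construction_order (Suc m)"]) (auto simp: N_def)
  qed
  moreover have "\<forall>n\<in>N. n \<ge> 1"
    using big by (auto simp: N_def intro: order_trans)
  moreover have "(\<epsilon> \<longlongrightarrow> 0) (inf at_top (principal N))"
  proof -
    have "(\<epsilon> \<longlongrightarrow> 0) at_top" unfolding \<epsilon>_def by real_asymp
    then show ?thesis by (rule tendsto_mono[rotated]) simp
  qed
  moreover have "real (Ni n) \<ge> 2 powr (real n - 2 powr ((1 + \<epsilon> n) * sqrt (log 2 (real n))))" if n: "n \<in> N" for n
  proof -
    obtain R where R: "R \<ge> 1" "n = construction_order R" using n by (auto simp: N_def)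
    define s where "s = sqrt (log 2 (real n))"
    have "real (2 ^ (R * R)) \<le> real n"
      using construction_order_ge[of R] unfolding R(2) by (simp only: of_nat_le_iff)
    then have n_ge: "2 ^ (R * R) \<le> real n" by simp
    have "real (R * R) = log 2 (2 ^ (R * R))" by (rule log_pow_cancel[symmetric]) simp_all
    also have "\<dots> \<le> log 2 (real n)" by (rule log_mono) (use n_ge in simp_all)
    finally have "(real R)\<^sup>2 \<le> log 2 (real n)" by (simp add: power2_eq_square)
    then have s: "real R \<le> s" unfolding s_def by (rule real_le_rsqrt)
    then have s0: "s > 0" using R(1) by linarith
    have "(1 + \<epsilon> n) * s = s + log 2 (2 * (s + 1) ^ 3)"
      using s0 by (simp add: \<epsilon>_def s_def[symmetric] field_simps)
    then have "2 powr ((1 + \<epsilon> n) * s) = 2 powr s * (2 * (s + 1) ^ 3)"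
      using s0 by (simp add: powr_add)
    moreover have "2 ^ R * (2 * (real R + 1) ^ 3) \<le> 2 powr s * (2 * (s + 1) ^ 3)"
    proof (rule mult_mono)
      have "(2::real) ^ R = 2 powr real R" by (simp add: powr_realpow)
      also have "\<dots> \<le> 2 powr s" by (rule powr_mono) (use s in auto)
      finally show "(2::real) ^ R \<le> 2 powr s" .
      show "2 * (real R + 1) ^ 3 \<le> 2 * (s + 1) ^ 3"
        using s by (intro mult_left_mono power_mono) auto
    qed auto
    ultimately have "2 powr (real n - 2 powr ((1 + \<epsilon> n) * s)) \<le> 2 powr (real n - 2 ^ R * (2 * (real R + 1) ^ 3))"
      by (intro powr_mono) auto
    also have "\<dots> \<le> real (Ni n)" using Ni_construction_order_ge[of R] R by simp
    finally show ?thesis unfolding s_def .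
  qed
  ultimately show ?thesis by blast
qed

theorem theorem1p3:
  shows "(\<exists>C::real. C > 0 \<and>
            (\<forall>n::nat. n \<ge> 1 \<longrightarrow> real (Ni n) \<le> C * (2 ^ n * real n powr (- 0.2075))))
       \<and> (\<exists>(N::nat set) (\<epsilon>::nat \<Rightarrow> real).
            infinite N \<and> (\<forall>n\<in>N. n \<ge> 1)
          \<and> (\<epsilon> \<longlongrightarrow> 0) (inf at_top (principal N))
          \<and> (\<forall>n\<in>N. real (Ni n) \<ge>
                2 powr (real n - 2 powr ((1 + \<epsilon> n) * sqrt (log 2 (real n))))))"
  using Ni_upper_bound Ni_lower_bound by blast

end
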